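(* Let $m_1 \geq 3$ be an integer and let $m_2 \geq m_1(2m_1-1)$ be an integer. Then: (i) if $m_1+m_2 \equiv 0,3 \pmod 4$, there exists a graceful two nested cycles graph whose base cycle has length $m_2$ and whose chords form a cycle of length $m_1$, i.e. $\mathcal{N}_g(m_1,m_2)\neq\emptyset$; (ii) if $m_1+m_2 \equiv 1,2 \pmod 4$, there exists a near-graceful two nested cycles graph whose base cycle has length $m_2$ and whose chords form a cycle of length $m_1$, i.e. $\mathcal{N}_{n\text{-}g}(m_1,m_2)\neq\emptyset$.
   Context: All graphs are finite and simple. A graph $G$ with $M$ edges is graceful if there is an injection $f:V(G)\to\{0,1,\ldots,M\}$ such that $\{|f(u)-f(v)| : uv\in E(G)\}=\{1,2,\ldots,M\}$. $G$ is near-graceful if it is not graceful and there is an injection $f:V(G)\to\{0,1,\ldots,M+1\}$ with $\{|f(u)-f(v)| : uv\in E(G)\}=\{1,2,\ldots,M-1\}\cup\{M+1\}$. A plane cycle with chords is a plane drawing of a Hamiltonian graph in which all vertices lie on the boundary cycle of the outer face (the base cycle), the remaining edges (chords) being drawn inside without crossings. A two nested cycles graph is a plane cycle with chords whose set of chords forms (induces) a cycle. $\mathcal{N}_g(m,n)$ (resp. $\mathcal{N}_{n\text{-}g}(m,n)$) denotes the set of graceful (resp. near-graceful) two nested cycles graphs with base cycle of length $n$ and chord cycle of length $m$; such a graph has $m+n$ edges. *)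

theory Defs
  imports "HOL-Analysis.Analysis"
begin

definition simple_graph :: "'a set \<Rightarrow> 'a set set \<Rightarrow> bool" where
  "simple_graph V E \<longleftrightarrow> finite V \<and> (\<forall>e\<in>E. e \<subseteq> V \<and> card e = 2)"

definition edge_differences :: "'a set set \<Rightarrow> ('a \<Rightarrow> int) \<Rightarrow> int set" where
  "edge_differences E f = {\<bar>f u - f v\<bar> | u v. {u, v} \<in> E}"

definition graceful :: "'a set \<Rightarrow> 'a set set \<Rightarrow> bool" where
  "graceful V E \<longleftrightarrow>
     (\<exists>f. inj_on f V \<and> f ` V \<subseteq> {0..int (card E)} \<and>
          edge_differences E f = {1..int (card E)})"

definition near_graceful :: "'a set \<Rightarrow> 'a set set \<Rightarrow> bool" where
  "near_graceful V E \<longleftrightarrow> \<not> graceful V E \<and>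
     (\<exists>f. inj_on f V \<and> f ` V \<subseteq> {0..int (card E) + 1} \<and>
          edge_differences E f = {1..int (card E) - 1} \<union> {int (card E) + 1})"

definition cycle_edges :: "'a list \<Rightarrow> 'a set set" where
  "cycle_edges vs = {{vs ! i, vs ! (Suc i mod length vs)} | i. i < length vs}"

definition is_cycle :: "'a list \<Rightarrow> 'a set set \<Rightarrow> bool" where
  "is_cycle vs C \<longleftrightarrow> distinct vs \<and> 3 \<le> length vs \<and> C = cycle_edges vs"

text \<open>A plane graph has points of the plane as vertices; \<open>\<gamma> e\<close> is the arc along which the edge
  \<open>e\<close> is drawn.  Distinct arcs may meet only in a common end vertex.  Values of \<open>\<gamma>\<close> outside \<open>E\<close>
  are irrelevant.\<close>

definition plane_graph ::
  "complex set \<Rightarrow> complex set set \<Rightarrow> (complex set \<Rightarrow> real \<Rightarrow> complex) \<Rightarrow> bool" where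
  "plane_graph V E \<gamma> \<longleftrightarrow> simple_graph V E \<and>
     (\<forall>e\<in>E. arc (\<gamma> e) \<and> {pathstart (\<gamma> e), pathfinish (\<gamma> e)} = e \<and>
            path_image (\<gamma> e) \<inter> V = e) \<and>
     (\<forall>e\<in>E. \<forall>e'\<in>E. e \<noteq> e' \<longrightarrow> path_image (\<gamma> e) \<inter> path_image (\<gamma> e') \<subseteq> e \<inter> e')"

definition drawn :: "(complex set \<Rightarrow> real \<Rightarrow> complex) \<Rightarrow> complex set set \<Rightarrow> complex set" where
  "drawn \<gamma> E = (\<Union>e\<in>E. path_image (\<gamma> e))"

text \<open>The list \<open>vs\<close> runs once around the base cycle.  The outer face of a drawing is the unbounded
  part \<open>outside (drawn \<gamma> E)\<close> of its complement.\<close>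

definition plane_cycle_with_chords ::
  "complex set \<Rightarrow> complex set set \<Rightarrow> (complex set \<Rightarrow> real \<Rightarrow> complex) \<Rightarrow> complex list \<Rightarrow> bool" where
  "plane_cycle_with_chords V E \<gamma> vs \<longleftrightarrow> plane_graph V E \<gamma> \<and>
     (\<exists>B. is_cycle vs B \<and> set vs = V \<and> B \<subseteq> E \<and>
          frontier (outside (drawn \<gamma> E)) = drawn \<gamma> B \<and>
          (\<forall>e\<in>E - B. path_image (\<gamma> e) - e \<subseteq> inside (drawn \<gamma> B)))"

definition two_nested_cycles ::
  "nat \<Rightarrow> nat \<Rightarrow> complex set \<Rightarrow> complex set set \<Rightarrow> (complex set \<Rightarrow> real \<Rightarrow> complex) \<Rightarrow> bool" where
  "two_nested_cycles m n V E \<gamma> \<longleftrightarrow>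
     (\<exists>vs ws. plane_cycle_with_chords V E \<gamma> vs \<and> length vs = n \<and>
              is_cycle ws (E - cycle_edges vs) \<and> length ws = m)"

definition nested_graceful ::
  "nat \<Rightarrow> nat \<Rightarrow> (complex set \<times> complex set set \<times> (complex set \<Rightarrow> real \<Rightarrow> complex)) set" where
  "nested_graceful m n = {(V, E, \<gamma>). two_nested_cycles m n V E \<gamma> \<and> graceful V E}"

definition nested_near_graceful ::
  "nat \<Rightarrow> nat \<Rightarrow> (complex set \<times> complex set set \<times> (complex set \<Rightarrow> real \<Rightarrow> complex)) set" where
  "nested_near_graceful m n = {(V, E, \<gamma>). two_nested_cycles m n V E \<gamma> \<and> near_graceful V E}"

end

theory Submission
  imports Defs
begin

text \<open>
  Write \<open>M = m + n\<close>. Label the base cycle by a zigzag \<open>0, M, 1, M - 1, 2, \<dots>\<close>, whose successive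
  differences decrease; skipping a label skips a difference. The odd positions carry consecutive
  decreasing labels near the start, so the vertices at positions \<open>1 + i (i + 1)\<close> for \<open>i < m\<close> have
  labels lying below the largest one by the triangular numbers, and the chords joining them in turn
  have differences \<open>1, \<dots>, m - 1\<close> and \<open>D = m (m - 1) / 2\<close>. The zigzag skips these \<open>m\<close>
  differences and one more, \<open>L\<close>, which is the label of its last vertex and hence the difference on
  the edge back to \<open>0\<close>. A suitable \<open>L\<close> near \<open>M / 2\<close> exists because of a parity condition, which
  is exactly the residue condition on \<open>M\<close> modulo 4; in the residue classes 1 and 2 the zigzag
  starts at \<open>M + 1\<close> and skips \<open>M\<close> in addition. All vertex degrees are even, so the same parity
  count excludes graceful labellings there. For the drawing, put the vertices on the unit
  circle, the base edges along its arcs and the chords straight.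
\<close>

subsection \<open>Edge differences on cycles\<close>

text \<open>If two equal edges matched with swapped ends, each index would be the cyclic successor
  of the other, which cannot happen on a cycle of length at least 3.\<close>

lemma inj_on_cycle_edge:
  assumes "distinct vs" "3 \<le> length vs"
  shows "inj_on (\<lambda>i. {vs ! i, vs ! (Suc i mod length vs)}) {..<length vs}"
proof (rule inj_onI)
  fix i j
  assume ij: "i \<in> {..<length vs}" "j \<in> {..<length vs}"
    and eq: "{vs ! i, vs ! (Suc i mod length vs)} = {vs ! j, vs ! (Suc j mod length vs)}"
  have "0 < length vs"
    using assms(2) by linarith
  then have "Suc i mod length vs < length vs" "Suc j mod length vs < length vs"
    by simp_all
  then have "i = j \<or> i = Suc j mod length vs \<and> Suc i mod length vs = j"
    using eq ij assms by (auto simp: doubleton_eq_iff nth_eq_iff_index_eq)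
  then show "i = j"
    using ij assms(2) by (auto simp: mod_Suc split: if_splits)
qed

lemma cycle_edges_eq_image:
  "cycle_edges vs = (\<lambda>i. {vs ! i, vs ! (Suc i mod length vs)}) ` {..<length vs}"
  by (auto simp: cycle_edges_def)

lemma finite_cycle_edges: "finite (cycle_edges vs)"
  by (simp add: cycle_edges_eq_image)

lemma card_cycle_edges:
  assumes "distinct vs" "3 \<le> length vs"
  shows "card (cycle_edges vs) = length vs"
  using card_image[OF inj_on_cycle_edge[OF assms]] by (simp add: cycle_edges_eq_image)

lemma edge_differences_cycle_edges:
  "edge_differences (cycle_edges vs) f
     = (\<lambda>i. \<bar>f (vs ! i) - f (vs ! (Suc i mod length vs))\<bar>) ` {..<length vs}"
  unfolding edge_differences_def cycle_edges_def
  by (fastforce simp: doubleton_eq_iff abs_minus_commute image_iff)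

lemma edge_differences_Un:
  "edge_differences (A \<union> B) f = edge_differences A f \<union> edge_differences B f"
  by (auto simp: edge_differences_def)

lemma bij_betw_Suc_mod: "bij_betw (\<lambda>i. Suc i mod n) {..<n} {..<n}"
proof -
  have "inj_on (\<lambda>i. Suc i mod n) {..<n}"
    by (rule inj_onI) (auto simp: mod_Suc split: if_splits)
  moreover have "(\<lambda>i. Suc i mod n) ` {..<n} \<subseteq> {..<n}"
    by auto
  ultimately show ?thesis
    by (simp add: bij_betw_def endo_inj_surj)
qed

text \<open>Around a cycle the signed differences cancel, and an absolute value has the parity of
  its argument.\<close>

lemma even_sum_cyclic_differences:
  fixes x :: "nat \<Rightarrow> int"
  shows "even (\<Sum>i<n. \<bar>x i - x (Suc i mod n)\<bar>)"
proof -
  have "(\<Sum>i<n. x (Suc i mod n)) = (\<Sum>i<n. x i)"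
    by (rule sum.reindex_bij_betw[OF bij_betw_Suc_mod])
  then have "(\<Sum>i<n. x i - x (Suc i mod n)) = 0"
    by (simp add: sum_subtractf)
  moreover have "even (\<Sum>i<n. \<bar>x i - x (Suc i mod n)\<bar> - (x i - x (Suc i mod n)))"
    by (rule dvd_sum) simp
  ultimately show ?thesis
    by (simp add: sum_subtractf[of "\<lambda>i. \<bar>x i - x (Suc i mod n)\<bar>"])
qed

lemma double_sum_interval_int: "2 * (\<Sum>i\<in>{1..int n}. i) = int n * (int n + 1)"
proof (induction n)
  case (Suc n)
  have "{1..int (Suc n)} = insert (int (Suc n)) {1..int n}"
    by auto
  then show ?case using Suc by (simp add: algebra_simps)
qed simp

text \<open>Modulo 2 the differences along a cycle sum to 0, whereas a graceful labelling realises
  each of \<open>1, \<dots>, M\<close> once.\<close>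
lemma graceful_two_cycles_mod_4:
  assumes vs: "distinct vs" "3 \<le> length vs" and ws: "distinct ws" "3 \<le> length ws"
    and disj: "cycle_edges vs \<inter> cycle_edges ws = {}"
    and graceful: "graceful V (cycle_edges vs \<union> cycle_edges ws)"
  shows "(length vs + length ws) mod 4 \<in> {0, 3}"
proof -
  define n where "n = length vs"
  define m where "m = length ws"
  have "card (cycle_edges vs \<union> cycle_edges ws) = n + m"
    using disj vs ws by (simp add: card_Un_disjoint finite_cycle_edges card_cycle_edges n_def m_def)
  then obtain f where f: "edge_differences (cycle_edges vs \<union> cycle_edges ws) f = {1..int (n + m)}"
    using graceful unfolding graceful_def by auto
  define g where "g i = \<bar>f (vs ! i) - f (vs ! (Suc i mod n))\<bar>" for i
  define h where "h i = \<bar>f (ws ! i) - f (ws ! (Suc i mod m))\<bar>" for i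
  \<comment> \<open>The differences of both cycles are put into one sequence of length
    \<open>n + m\<close>. Its image has \<open>n + m\<close> elements, so no difference repeats and
    the sum over edges equals the sum over values.\<close>
  define d where "d k = (if k < n then g k else h (k - n))" for k
  have "d ` {..<n + m} = g ` {..<n} \<union> h ` {..<m}"
  proof -
    have "{..<n + m} = {..<n} \<union> {n..<n + m}"
      by auto
    moreover have "{n..<n + m} = (\<lambda>i. i + n) ` {..<m}"
      by (simp add: lessThan_atLeast0 add.commute)
    ultimately have "d ` {..<n + m} = d ` {..<n} \<union> (\<lambda>i. d (i + n)) ` {..<m}"
      by (metis image_Un image_image)
    then show ?thesis
      by (simp add: d_def)
  qed
  also have "\<dots> = {1..int (n + m)}"
    using f by (simp add: edge_differences_Un edge_differences_cycle_edges g_def h_def n_def m_def)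
  finally have img: "d ` {..<n + m} = {1..int (n + m)}" .
  then have "inj_on d {..<n + m}"
    by (intro eq_card_imp_inj_on) auto
  then have "(\<Sum>k<n + m. d k) = (\<Sum>i\<in>{1..int (n + m)}. i)"
    using sum.reindex[of d "{..<n + m}" "\<lambda>i. i"] img by simp
  moreover have "(\<Sum>k<n + m. d k) = (\<Sum>i<n. g i) + (\<Sum>i<m. h i)"
  proof -
    have "(\<Sum>k<n + m. d k) = (\<Sum>k<n. d k) + (\<Sum>k=n..<n + m. d k)"
      by (metis atLeast0LessThan le_add1 sum.atLeastLessThan_concat zero_le)
    also have "(\<Sum>k=n..<n + m. d k) = (\<Sum>i<m. h i)"
      using sum.shift_bounds_nat_ivl[of d 0 n m] by (simp add: d_def add.commute atLeast0LessThan)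
    finally show ?thesis by (simp add: d_def)
  qed
  moreover have "even (\<Sum>i<n. g i)" "even (\<Sum>i<m. h i)"
    unfolding g_def h_def by (rule even_sum_cyclic_differences)+
  ultimately have "even (\<Sum>i\<in>{1..int (n + m)}. i)"
    by (metis dvd_add)
  then have "4 dvd int (n + m) * (int (n + m) + 1)"
    unfolding double_sum_interval_int[symmetric] by (auto elim!: evenE)
  then have "int 4 dvd int ((n + m) * (n + m + 1))"
    by (simp add: algebra_simps)
  then have "4 dvd (n + m) * (n + m + 1)"
    by (simp only: int_dvd_int_iff)
  define a b where "a = (n + m) mod 4" and "b = (n + m + 1) mod 4"
  have "a * b mod 4 = 0"
    using \<open>4 dvd (n + m) * (n + m + 1)\<close>
    unfolding a_def b_def by (simp add: dvd_eq_mod_eq_0 mod_mult_eq)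
  moreover have "b = (if a = 3 then 0 else a + 1)"
    by (simp add: a_def b_def mod_Suc)
  moreover have "a = 0 \<or> a = 1 \<or> a = 2 \<or> a = 3"
    unfolding a_def by linarith
  ultimately have "a = 0 \<or> a = 3"
    by (elim disjE) simp_all
  then show ?thesis
    by (simp add: a_def n_def m_def)
qed

subsection \<open>A convex drawing\<close>

text \<open>\<open>outside\<close> is antitone: comparison with the sphere bounds it from above, and
  convexity of the ball bounds it from below. Whatever is drawn inside the disc thus leaves the
  outer face unchanged.\<close>

lemma outside_eq_compl_cball:
  fixes c :: "'a :: euclidean_space"
  assumes "sphere c r \<subseteq> X" "X \<subseteq> cball c r" "0 < r"
  shows "outside X = - cball c r"
proof
  have "outside (sphere c r) = - cball c r"
    using outside_frontier_eq_complement_closure[of "cball c r"] \<open>0 < r\<close> by simp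
  then show "outside X \<subseteq> - cball c r"
    using outside_mono[OF assms(1)] by simp
  show "- cball c r \<subseteq> outside X"
    using outside_subset_convex[of "cball c r" X] assms(2) by simp
qed

text \<open>The line \<open>l = k\<close> through \<open>a\<close> and \<open>b\<close> has the
  second segment on one side, so it can touch that segment only at an end, unless both ends lie on
  it. In that case both would be in \<open>{a, b}\<close>, and the segments would have the same
  ends.\<close>

lemma segments_meet_in_common_ends:
  fixes a b a' b' :: "'a :: real_vector" and l :: "'a \<Rightarrow> real"
  assumes lin: "linear l"
    and ab: "l a = k" "l b = k"
    and le: "l a' \<le> k" "l b' \<le> k"
    and eq: "l a' = k \<Longrightarrow> a' \<in> {a, b}" "l b' = k \<Longrightarrow> b' \<in> {a, b}"
    and ne: "{a, b} \<noteq> {a', b'}" "a' \<noteq> b'"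
  shows "closed_segment a b \<inter> closed_segment a' b' \<subseteq> {a, b} \<inter> {a', b'}"
proof
  fix z assume "z \<in> closed_segment a b \<inter> closed_segment a' b'"
  then have "\<exists>u. z = (1 - u) *\<^sub>R a + u *\<^sub>R b"
    and "\<exists>v. z = (1 - v) *\<^sub>R a' + v *\<^sub>R b' \<and> 0 \<le> v \<and> v \<le> 1"
    unfolding closed_segment_def by blast+
  then obtain u v where u: "z = (1 - u) *\<^sub>R a + u *\<^sub>R b"
    and v: "z = (1 - v) *\<^sub>R a' + v *\<^sub>R b'" "0 \<le> v" "v \<le> 1"
    by blast
  have "l z = (1 - u) * k + u * k"
    unfolding u using ab by (simp add: linear_add[OF lin] linear_scale[OF lin])
  then have "l z = k" by (simp add: algebra_simps)
  moreover have "l z = (1 - v) * l a' + v * l b'"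
    unfolding v(1) by (simp add: linear_add[OF lin] linear_scale[OF lin])
  ultimately have "(1 - v) * (k - l a') + v * (k - l b') = 0"
    by (simp add: algebra_simps)
  moreover have "0 \<le> (1 - v) * (k - l a')" "0 \<le> v * (k - l b')"
    using v le by simp_all
  ultimately have "(1 - v) * (k - l a') = 0" "v * (k - l b') = 0"
    by linarith+
  then have "v = 1 \<or> l a' = k" "v = 0 \<or> l b' = k"
    by auto
  then show "z \<in> {a, b} \<inter> {a', b'}"
    using eq ne v(1) by auto
qed

text \<open>The chord cycle visits the base positions \<open>q 0 < q 1 < \<dots>\<close>. The gaps
  of 2 keep its chords off the base edges. Position 0 stays free, so the closing chord is not the
  base edge that wraps around.\<close>

locale inscribed_cycle =
  fixes n m :: nat and q :: "nat \<Rightarrow> nat"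
  assumes m: "3 \<le> m"
    and gap: "\<And>i. Suc i < m \<Longrightarrow> q i + 2 \<le> q (Suc i)"
    and q0: "0 < q 0"
    and q_last: "q (m - 1) < n"
begin

lemma q_less: "i < j \<Longrightarrow> j < m \<Longrightarrow> q i + 2 \<le> q j"
proof (induction j)
  case (Suc j)
  then show ?case using gap[of j] by (cases "i = j") auto
qed simp

lemma q_less_n:
  assumes "i < m"
  shows "q i < n"
proof (cases "i = m - 1")
  case False
  then have "i < m - 1" using assms by linarith
  then show ?thesis using q_less[of i "m - 1"] q_last by simp
qed (use q_last in simp)

lemma q_eq_iff: "i < m \<Longrightarrow> j < m \<Longrightarrow> q i = q j \<longleftrightarrow> i = j"
  using q_less[of i j] q_less[of j i] by (cases i j rule: linorder_cases) auto

lemma n_ge: "3 \<le> n"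
  using q_less[of 0 "m - 1"] q_last m q0 by simp

text \<open>The argument is real so that integers give the vertices and unit intervals give the base
  arcs.\<close>

definition W :: "real \<Rightarrow> complex" where
  "W x = cis (2 * pi * x / n)"

lemma norm_W: "norm (W x) = 1"
  by (simp add: W_def)

lemma W_n: "W (real n) = W 0"
  using n_ge by (simp add: W_def)

lemma W_eq_iff:
  fixes x y :: real
  assumes "0 \<le> x" "x < n" "0 \<le> y" "y < n"
  shows "W x = W y \<longleftrightarrow> x = y"
proof
  assume "W x = W y"
  then have "exp (\<i> * of_real (2 * pi * x / n)) = exp (\<i> * of_real (2 * pi * y / n))"
    by (simp add: W_def cis_conv_exp)
  moreover have "\<bar>2 * pi * x / n - 2 * pi * y / n\<bar> < 2 * pi"
  proof -
    have "2 * pi * x / n - 2 * pi * y / n = 2 * pi * ((x - y) / n)"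
      by (simp add: diff_divide_distrib right_diff_distrib)
    then have "\<bar>2 * pi * x / n - 2 * pi * y / n\<bar> = 2 * pi * (\<bar>x - y\<bar> / n)"
      by (simp add: abs_mult)
    moreover have "\<bar>x - y\<bar> < real n"
      using assms by linarith
    then have "\<bar>x - y\<bar> / n < 1"
      using n_ge by simp
    then have "2 * pi * (\<bar>x - y\<bar> / n) < 2 * pi * 1"
      by (intro mult_strict_left_mono) auto
    ultimately show ?thesis by simp
  qed
  ultimately have "\<i> * of_real (2 * pi * x / n) = \<i> * of_real (2 * pi * y / n)"
    using exp_complex_eqI[of "\<i> * of_real (2 * pi * x / n)" "\<i> * of_real (2 * pi * y / n)"]
    by simp
  then have "2 * pi * x / n = 2 * pi * y / n"
    by (metis mult_cancel_left complex_i_not_zero of_real_eq_iff)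
  then show "x = y"
    using n_ge by simp
qed simp

lemma W_eq_iff_nat:
  "i < n \<Longrightarrow> j < n \<Longrightarrow> W (real i) = W (real j) \<longleftrightarrow> i = j"
  by (simp add: W_eq_iff)

lemma W_Suc_mod: "k < n \<Longrightarrow> W (real (Suc k mod n)) = W (real k + 1)"
proof (cases "Suc k = n")
  case True
  then have "real k + 1 = real n" by simp
  then show ?thesis using True W_n by (metis mod_self of_nat_0)
qed (simp add: add.commute)

lemma sphere_eq: "sphere 0 1 = W ` {0..<real n}"
proof
  show "sphere 0 1 \<subseteq> W ` {0..<real n}"
  proof
    fix z :: complex assume "z \<in> sphere 0 1"
    then have z: "norm z = 1" by simp
    define x where "x = n * Arg2pi z / (2 * pi)"
    have "W x = z"
      using Arg2pi_eq[of z] z n_ge by (simp add: W_def x_def cis_conv_exp)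
    moreover have "0 \<le> x" "x < n"
      using Arg2pi_ge_0[of z] Arg2pi_lt_2pi[of z] n_ge by (simp_all add: x_def field_simps)
    ultimately show "z \<in> W ` {0..<real n}" by force
  qed
qed (auto simp: norm_W)

definition base :: "complex list" where
  "base = map (\<lambda>i. W (real i)) [0..<n]"

definition ring :: "complex list" where
  "ring = map (\<lambda>i. W (real (q i))) [0..<m]"

abbreviation V :: "complex set" where
  "V \<equiv> set base"

abbreviation E :: "complex set set" where
  "E \<equiv> cycle_edges base \<union> cycle_edges ring"

definition base_arc :: "nat \<Rightarrow> real \<Rightarrow> complex" where
  "base_arc k t = W (real k + t)"

text \<open>The second end is not reduced modulo \<open>n\<close>: by periodicity the last edge then
  has the same form as the others.\<close>

definition base_edge :: "nat \<Rightarrow> complex set" where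
  "base_edge k = {W (real k), W (real k + 1)}"

definition chord :: "nat \<Rightarrow> complex set" where
  "chord i = {W (real (q i)), W (real (q (Suc i mod m)))}"

lemma base_simps: "length base = n" "distinct base" "V = (\<lambda>i. W (real i)) ` {..<n}"
  by (auto simp: base_def distinct_map inj_on_def W_eq_iff_nat)

lemma ring_simps: "length ring = m" "distinct ring"
  by (auto simp: ring_def distinct_map inj_on_def W_eq_iff_nat q_less_n q_eq_iff)

lemma cycle_edges_base: "cycle_edges base = base_edge ` {..<n}"
  unfolding cycle_edges_eq_image
  by (rule image_cong) (use n_ge in \<open>auto simp: base_simps base_edge_def base_def W_Suc_mod\<close>)

lemma cycle_edges_ring: "cycle_edges ring = chord ` {..<m}"
  unfolding cycle_edges_eq_image
  by (rule image_cong) (use m in \<open>auto simp: ring_simps chord_def ring_def\<close>)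

lemma base_edge_subset: "k < n \<Longrightarrow> base_edge k \<subseteq> V"
proof -
  assume k: "k < n"
  then have "Suc k mod n < n" by simp
  then show ?thesis
    using k unfolding base_simps base_edge_def W_Suc_mod[OF k, symmetric] by blast
qed

lemma chord_subset: "i < m \<Longrightarrow> chord i \<subseteq> V"
  using q_less_n[of i] q_less_n[of "Suc i mod m"] by (auto simp: base_simps chord_def)

lemma chord_ends_distinct:
  assumes "i < m"
  shows "W (real (q i)) \<noteq> W (real (q (Suc i mod m)))"
proof -
  have "Suc i mod m < m" "Suc i mod m \<noteq> i"
    using assms m by (auto simp: mod_Suc)
  then show ?thesis
    using assms by (simp add: W_eq_iff_nat q_eq_iff q_less_n)
qed

lemma base_ends_distinct:
  assumes "k < n"
  shows "W (real k) \<noteq> W (real k + 1)"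
proof -
  have "Suc k mod n < n" "Suc k mod n \<noteq> k"
    using assms n_ge by (auto simp: mod_Suc)
  then show ?thesis
    using assms unfolding W_Suc_mod[OF assms, symmetric] by (simp add: W_eq_iff_nat)
qed

text \<open>A base edge joins consecutive positions or contains position 0. No chord vertex is at
  position 0, and the ends of every chord, including the closing one, are at least 2 positions
  apart.\<close>

lemma base_ring_disjoint: "cycle_edges base \<inter> cycle_edges ring = {}"
proof -
  have "base_edge k \<noteq> chord i" if "k < n" "i < m" for k i
  proof
    assume eq: "base_edge k = chord i"
    have *: "Suc k mod n < n" "Suc i mod m < m" using that by simp_all
    have "{W (real k), W (real (Suc k mod n))} = {W (real (q i)), W (real (q (Suc i mod m)))}"
      using eq unfolding base_edge_def chord_def W_Suc_mod[OF that(1)] .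
    then have "k = q i \<and> Suc k mod n = q (Suc i mod m) \<or> k = q (Suc i mod m) \<and> Suc k mod n = q i"
      unfolding doubleton_eq_iff
      using W_eq_iff_nat[OF that(1) q_less_n] W_eq_iff_nat[OF *(1) q_less_n] that(2) *(2) by blast
    moreover have "q i + 2 \<le> q (Suc i mod m) \<or> i = m - 1 \<and> Suc i mod m = 0"
      using gap[of i] that by (auto simp: mod_Suc)
    moreover have "q 0 + 2 + 2 \<le> q (m - 1)"
      using q_less[of 0 1] q_less[of 1 "m - 1"] m by (simp add: less_diff_conv)
    moreover have "0 < q j" if "j < m" for j
      using q_less[of 0 j] that q0 by (cases "j = 0") auto
    then have "0 < q i" "0 < q (Suc i mod m)"
      using that * by blast+
    moreover have "Suc k mod n = Suc k \<or> Suc k mod n = 0"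
      using that(1) by (simp add: mod_Suc)
    ultimately show False
      by auto
  qed
  then show ?thesis
    by (auto simp: cycle_edges_base cycle_edges_ring)
qed

lemma card_E: "card E = m + n"
  using base_ring_disjoint m n_ge
  by (simp add: card_Un_disjoint finite_cycle_edges card_cycle_edges base_simps ring_simps)

lemma path_image_base_arc: "path_image (base_arc k) = W ` {real k..real k + 1}"
proof -
  have "{real k..real k + 1} = (\<lambda>t. real k + t) ` {0..1}"
    by simp
  then show ?thesis
    by (simp only: path_image_def base_arc_def[abs_def] image_image)
qed

lemma base_arc_ends: "{pathstart (base_arc k), pathfinish (base_arc k)} = base_edge k"
  by (simp add: pathstart_def pathfinish_def base_arc_def base_edge_def)

text \<open>On the closed interval up to \<open>n\<close>, which the last base arc reaches, the only
  coincidence is that of the two ends.\<close>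

lemma W_eqD:
  fixes x y :: real
  assumes "W x = W y" "0 \<le> x" "x \<le> y" "y \<le> n"
  shows "x = y \<or> x = 0 \<and> y = n"
proof (cases "y = n")
  case True
  then have "W x = W 0" using assms W_n by simp
  then show ?thesis using assms True W_eq_iff[of x 0] n_ge by (cases "x = n") auto
next
  case False
  then show ?thesis using assms W_eq_iff[of x y] by auto
qed

lemma arc_base_arc:
  assumes "k < n"
  shows "arc (base_arc k)"
  unfolding arc_def
proof
  show "path (base_arc k)"
    unfolding path_def base_arc_def W_def by (intro continuous_intros) (use n_ge in auto)
  have "s = t" if "s \<in> {0..1}" "t \<in> {0..1}" "base_arc k s = base_arc k t" "s \<le> t" for s t
    using W_eqD[of "real k + s" "real k + t"] that assms n_ge by (auto simp: base_arc_def)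
  then show "inj_on (base_arc k) {0..1}"
    by (metis (no_types, lifting) inj_onI linear)
qed

lemma base_arc_Int_V:
  assumes "k < n"
  shows "path_image (base_arc k) \<inter> V = base_edge k"
proof
  show "base_edge k \<subseteq> path_image (base_arc k) \<inter> V"
    using base_edge_subset[OF assms] by (auto simp: path_image_base_arc base_edge_def)
  show "path_image (base_arc k) \<inter> V \<subseteq> base_edge k"
  proof
    fix z assume "z \<in> path_image (base_arc k) \<inter> V"
    then obtain x i where x: "real k \<le> x" "x \<le> real k + 1" "z = W x"
      and i: "i < n" "z = W (real i)"
      by (auto simp: path_image_base_arc base_simps)
    have "x = real i \<or> x = n \<and> i = 0"
      using W_eqD[of x "real i"] W_eqD[of "real i" x] x i assms by (cases "x \<le> real i") auto
    then have "x = real k \<or> x = real k + 1"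
      using x assms by (metis Suc_leI add.commute antisym of_nat_Suc of_nat_le_iff not_less_eq_eq order.trans)
    then show "z \<in> base_edge k"
      using x by (auto simp: base_edge_def)
  qed
qed

lemma base_arcs_meet:
  assumes "k < l" "l < n"
  shows "path_image (base_arc k) \<inter> path_image (base_arc l) \<subseteq> base_edge k \<inter> base_edge l"
proof
  fix z assume "z \<in> path_image (base_arc k) \<inter> path_image (base_arc l)"
  then obtain x y where x: "real k \<le> x" "x \<le> real k + 1" "z = W x"
    and y: "real l \<le> y" "y \<le> real l + 1" "z = W y"
    by (auto simp: path_image_base_arc)
  have "real k + 1 \<le> real l" "real l + 1 \<le> real n" using assms by linarith+
  then have "x \<le> y" "0 \<le> x" "y \<le> n" using x y by linarith+
  then have "x = y \<or> x = 0 \<and> y = n"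
    using W_eqD[of x y] x y by simp
  then show "z \<in> base_edge k \<inter> base_edge l"
  proof
    assume "x = y"
    then have "x = real k + 1" "y = real l"
      using x y \<open>real k + 1 \<le> real l\<close> by linarith+
    then show ?thesis using x y by (simp add: base_edge_def)
  next
    assume "x = 0 \<and> y = n"
    then have "x = real k" "y = real l + 1"
      using x y \<open>real l + 1 \<le> real n\<close> by linarith+
    then show ?thesis using x y by (simp add: base_edge_def)
  qed
qed

lemma drawn_base_arcs: "(\<Union>k<n. path_image (base_arc k)) = sphere 0 1"
proof
  show "(\<Union>k<n. path_image (base_arc k)) \<subseteq> sphere 0 1"
    by (auto simp: path_image_base_arc norm_W)
  show "sphere 0 1 \<subseteq> (\<Union>k<n. path_image (base_arc k))"
  proof
    fix z :: complex assume "z \<in> sphere 0 1"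
    then obtain x :: real where x: "0 \<le> x" "x < n" "z = W x"
      by (auto simp: sphere_eq)
    define k where "k = nat \<lfloor>x\<rfloor>"
    have "real k \<le> x" "x \<le> real k + 1" "k < n"
      using x by (auto simp: k_def nat_less_iff floor_less_iff)
    then show "z \<in> (\<Union>k<n. path_image (base_arc k))"
      using x(3) by (force simp: path_image_base_arc)
  qed
qed

text \<open>An inner point of a segment is strictly closer to the centre than one of the
  ends.\<close>

lemma open_chord_subset_ball:
  assumes "norm a = 1" "norm b = 1"
  shows "closed_segment a b - {a, b} \<subseteq> ball (0::complex) 1"
proof
  fix z assume "z \<in> closed_segment a b - {a, b}"
  then have "z \<in> open_segment a b" by (simp add: open_segment_def)
  then show "z \<in> ball 0 1"
    using dist_decreases_open_segment[of z a b 0] assms by (auto simp: dist_norm)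
qed

text \<open>The linear form \<open>l\<close> takes the value \<open>cos (pi * (y - x) / n)\<close> on the chord from \<open>W x\<close> to
  \<open>W y\<close>, so the sign of the right-hand side tells on which side of that chord \<open>W z\<close> lies.\<close>
lemma chord_side:
  fixes x y z :: real
  defines "l \<equiv> \<lambda>z. Re (z * cis (- (pi * (x + y) / n)))"
  shows "l (W z) - cos (pi * (y - x) / n) = 2 * sin (pi * (z - x) / n) * sin (pi * (y - z) / n)"
proof -
  have "l (W z) = cos (2 * pi * z / n - pi * (x + y) / n)"
    by (simp add: l_def W_def cos_diff)
  also have "\<dots> - cos (pi * (y - x) / n) = 2 * sin (pi * (z - x) / n) * sin (pi * (y - z) / n)"
    unfolding cos_diff_cos by (simp add: algebra_simps diff_divide_distrib add_divide_distrib)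
  finally show ?thesis .
qed

lemma sin_pos:
  fixes x :: real
  assumes "0 < x" "x < n"
  shows "0 < sin (pi * x / n)"
  using assms n_ge by (intro sin_gt_zero) (auto simp: field_simps)

text \<open>This is convex position: all remaining chord vertices lie strictly on one side of the
  line through a chord, by the signs of the two sines in \<open>chord_side\<close>.\<close>

lemma supporting_line:
  assumes "i < m"
  obtains l :: "complex \<Rightarrow> real" and k where "linear l"
    "l (W (real (q i))) = k" "l (W (real (q (Suc i mod m)))) = k"
    "\<And>j. j < m \<Longrightarrow> j \<noteq> i \<Longrightarrow> j \<noteq> Suc i mod m \<Longrightarrow> l (W (real (q j))) < k"
proof -
  define x y where "x = real (q i)" and "y = real (q (Suc i mod m))"
  define l where "l = (\<lambda>z. Re (z * cis (- (pi * (x + y) / n))))"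
  define k where "k = cos (pi * (y - x) / n)"
  have lin: "linear l"
    unfolding l_def by (rule linearI) (simp_all add: algebra_simps)
  have side: "l (W z) - k = 2 * (sin (pi * (z - x) / n) * sin (pi * (y - z) / n))" for z
    using chord_side[where x = x and y = y and z = z] by (simp only: l_def k_def mult.assoc)
  have ends: "l (W x) = k" "l (W y) = k"
    using side[of x] side[of y] by simp_all
  have pos: "0 < sin (pi * (z - w) / n)" and neg: "sin (pi * (w - z) / n) < 0"
    if "w < z" "0 \<le> w" "z < n" for z w :: real
  proof -
    show "0 < sin (pi * (z - w) / n)" using sin_pos[of "z - w"] that by simp
    moreover have "pi * (w - z) / n = - (pi * (z - w) / n)"
      by (simp add: right_diff_distrib diff_divide_distrib)
    ultimately show "sin (pi * (w - z) / n) < 0" by (metis neg_less_0_iff_less sin_minus)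
  qed
  have xy: "0 \<le> x" "x < n" "0 \<le> y" "y < n"
    using q_less_n[of i] q_less_n[of "Suc i mod m"] assms by (simp_all add: x_def y_def)
  show ?thesis
  proof (cases "Suc i = m")
    case True
    \<comment> \<open>For the closing chord \<open>y < x\<close>, and the other vertices lie between
      them. The sign is then reversed, so \<open>- l\<close> is the form to use.\<close>
    have "l (W (real (q j))) > k" if j: "j < m" "j \<noteq> i" "j \<noteq> Suc i mod m" for j
    proof -
      have "y < real (q j)" "real (q j) < x"
        using q_less[of 0 j] q_less[of j i] j True by (auto simp: x_def y_def)
      then have "0 < sin (pi * (real (q j) - x) / n) * sin (pi * (y - real (q j)) / n)"
        using neg[of "real (q j)" x] neg[of y "real (q j)"] xy by (intro mult_neg_neg) auto
      then show ?thesis using side[of "real (q j)"] by linarith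
    qed
    then show ?thesis
      using that[of "\<lambda>z. - l z" "- k"] linear_compose_neg[OF lin] ends by (simp add: x_def y_def)
  next
    case False
    then have Suc_i: "Suc i mod m = Suc i" using assms by simp
    have "l (W (real (q j))) < k" if j: "j < m" "j \<noteq> i" "j \<noteq> Suc i mod m" for j
    proof -
      have "sin (pi * (real (q j) - x) / n) * sin (pi * (y - real (q j)) / n) < 0"
      proof (cases "j < i")
        case True
        then have "real (q j) < x" "x < y"
          using q_less[of j i] gap[of i] assms False unfolding x_def y_def Suc_i by auto
        then show ?thesis
          using neg[of "real (q j)" x] pos[of "real (q j)" y] xy by (intro mult_neg_pos) auto
      next
        case jf: False
        then have "y < real (q j)" "x < y"
          using q_less[of "Suc i" j] gap[of i] assms j False unfolding x_def y_def Suc_i by auto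
        then show ?thesis
          using pos[of x "real (q j)"] neg[of y "real (q j)"] xy q_less_n[of j] j
          by (intro mult_pos_neg) auto
      qed
      then show ?thesis using side[of "real (q j)"] by linarith
    qed
    then show ?thesis
      using that[of l k] lin ends by (simp add: x_def y_def)
  qed
qed

lemma chords_meet:
  assumes "i < m" "j < m" "chord i \<noteq> chord j"
  shows "closed_segment (W (real (q i))) (W (real (q (Suc i mod m))))
       \<inter> closed_segment (W (real (q j))) (W (real (q (Suc j mod m)))) \<subseteq> chord i \<inter> chord j"
proof -
  obtain l :: "complex \<Rightarrow> real" and k where l: "linear l"
    "l (W (real (q i))) = k" "l (W (real (q (Suc i mod m)))) = k"
    "\<And>j. j < m \<Longrightarrow> j \<noteq> i \<Longrightarrow> j \<noteq> Suc i mod m \<Longrightarrow> l (W (real (q j))) < k"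
    using supporting_line[OF assms(1)] by blast
  have *: "l (W (real (q j))) \<le> k \<and>
      (l (W (real (q j))) = k \<longrightarrow> W (real (q j)) \<in> {W (real (q i)), W (real (q (Suc i mod m)))})"
    if "j < m" for j
    using l(2,3) l(4)[OF that] by (cases "j = i \<or> j = Suc i mod m") auto
  show ?thesis
    unfolding chord_def
    by (rule segments_meet_in_common_ends[OF l(1-3)])
      (use *[of j] *[of "Suc j mod m"] chord_ends_distinct[of j] assms in \<open>auto simp: chord_def\<close>)
qed

lemma chord_Int_sphere:
  assumes "i < m"
  shows "closed_segment (W (real (q i))) (W (real (q (Suc i mod m)))) \<inter> sphere 0 1 = chord i"
  using open_chord_subset_ball[of "W (real (q i))" "W (real (q (Suc i mod m)))"]
  by (force simp: chord_def norm_W)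

lemma inj_on_base_edge: "inj_on base_edge {..<n}"
  by (rule eq_card_imp_inj_on)
    (use card_cycle_edges[of base] n_ge in \<open>simp_all add: base_simps cycle_edges_base\<close>)

lemma V_subset_sphere: "V \<subseteq> sphere 0 1"
  by (auto simp: base_simps norm_W)

lemma ex_plane_drawing: "\<exists>\<gamma>. two_nested_cycles m n V E \<gamma>"
proof -
  define seg where "seg i = linepath (W (real (q i))) (W (real (q (Suc i mod m))))" for i
  \<comment> \<open>The drawing is chosen edge by edge. The membership tags, with disjointness of
    the two cycles, recover later which kind of curve was chosen.\<close>
  have "\<forall>e\<in>E. \<exists>g. e \<in> cycle_edges base \<and> (\<exists>k<n. e = base_edge k \<and> g = base_arc k)
      \<or> e \<in> cycle_edges ring \<and> (\<exists>i<m. e = chord i \<and> g = seg i)"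
    by (auto simp: cycle_edges_base cycle_edges_ring)
  then obtain \<gamma> where \<gamma>: "\<forall>e\<in>E. e \<in> cycle_edges base \<and> (\<exists>k<n. e = base_edge k \<and> \<gamma> e = base_arc k)
      \<or> e \<in> cycle_edges ring \<and> (\<exists>i<m. e = chord i \<and> \<gamma> e = seg i)"
    by (auto dest!: bchoice)
  have base: "\<exists>k<n. e = base_edge k \<and> \<gamma> e = base_arc k" if "e \<in> cycle_edges base" for e
    using \<gamma> that base_ring_disjoint by blast
  have ring: "\<exists>i<m. e = chord i \<and> \<gamma> e = seg i" if "e \<in> cycle_edges ring" for e
    using \<gamma> that base_ring_disjoint by blast
  have seg: "path_image (seg i) = closed_segment (W (real (q i))) (W (real (q (Suc i mod m))))" for i
    by (simp add: seg_def)
  have arc_sphere: "path_image (base_arc k) \<subseteq> sphere 0 1" if "k < n" for k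
    using drawn_base_arcs that by blast
  \<comment> \<open>The arc lies on the circle, which the chord meets only in its two ends. These
    are vertices, and the arc contains no vertices but its own ends.\<close>
  have base_chord: "path_image (base_arc k) \<inter> path_image (seg i) \<subseteq> base_edge k \<inter> chord i"
    if "k < n" "i < m" for k i
    using arc_sphere[OF that(1)] chord_Int_sphere[OF that(2)] chord_subset[OF that(2)]
      base_arc_Int_V[OF that(1)] unfolding seg by blast
  have edge: "e \<subseteq> V \<and> card e = 2 \<and> arc (\<gamma> e) \<and> {pathstart (\<gamma> e), pathfinish (\<gamma> e)} = e
      \<and> path_image (\<gamma> e) \<inter> V = e" if e: "e \<in> E" for e
  proof (cases "e \<in> cycle_edges base")
    case True
    then obtain k where k: "k < n" "e = base_edge k" "\<gamma> e = base_arc k"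
      using base by blast
    then show ?thesis
      using base_edge_subset[of k] base_ends_distinct[of k] arc_base_arc[of k] base_arc_ends[of k]
        base_arc_Int_V[of k]
      by (simp add: base_edge_def)
  next
    case False
    then obtain i where i: "i < m" "e = chord i" "\<gamma> e = seg i"
      using e ring by blast
    have "path_image (seg i) \<inter> V = chord i"
      using chord_Int_sphere[OF i(1)] V_subset_sphere chord_subset[OF i(1)] unfolding seg by blast
    then show ?thesis
      using i chord_subset[of i] chord_ends_distinct[of i]
      by (simp add: chord_def seg_def)
  qed
  have meet: "path_image (\<gamma> e) \<inter> path_image (\<gamma> e') \<subseteq> e \<inter> e'"
    if e: "e \<in> E" "e' \<in> E" "e \<noteq> e'" for e e'
  proof -
    consider (bb) k l where "k < n" "e = base_edge k" "\<gamma> e = base_arc k"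
        "l < n" "e' = base_edge l" "\<gamma> e' = base_arc l"
      | (bc) k i where "k < n" "e = base_edge k" "\<gamma> e = base_arc k"
        "i < m" "e' = chord i" "\<gamma> e' = seg i"
      | (cb) i k where "k < n" "e' = base_edge k" "\<gamma> e' = base_arc k"
        "i < m" "e = chord i" "\<gamma> e = seg i"
      | (cc) i j where "i < m" "e = chord i" "\<gamma> e = seg i" "j < m" "e' = chord j" "\<gamma> e' = seg j"
      using e(1,2) base ring by (metis UnE)
    then show ?thesis
    proof cases
      case bb
      then have "k \<noteq> l" using e by auto
      then show ?thesis
        using base_arcs_meet[of k l] base_arcs_meet[of l k] bb by (cases k l rule: linorder_cases) auto
    next
      case bc
      then show ?thesis using base_chord by metis
    next
      case cb
      then show ?thesis using base_chord by (metis Int_commute)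
    next
      case cc
      then show ?thesis using chords_meet[of i j] e seg by metis
    qed
  qed
  have plane: "plane_graph V E \<gamma>"
    unfolding plane_graph_def simple_graph_def using edge meet by auto
  have "drawn \<gamma> (cycle_edges base) = (\<Union>k<n. path_image (base_arc k))"
  proof -
    \<comment> \<open>The choice only provides some index with the same edge; injectivity of
      \<open>base_edge\<close> identifies it with \<open>k\<close>.\<close>
    have "\<gamma> (base_edge k) = base_arc k" if "k < n" for k
      using base[of "base_edge k"] that inj_on_base_edge
      by (auto simp: cycle_edges_base inj_on_eq_iff)
    then show ?thesis
      by (auto simp: drawn_def cycle_edges_base)
  qed
  then have drawn_base: "drawn \<gamma> (cycle_edges base) = sphere 0 1"
    by (simp add: drawn_base_arcs)
  have inside: "inside (sphere 0 1) = ball (0::complex) 1"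
    using inside_frontier_eq_interior[of "cball (0::complex) 1"] by simp
  have chord_inside: "path_image (\<gamma> e) - e \<subseteq> ball 0 1" if e: "e \<in> cycle_edges ring" for e
  proof -
    obtain i where "e = chord i" "\<gamma> e = seg i"
      using ring[OF e] by blast
    then show ?thesis
      using open_chord_subset_ball[of "W (real (q i))" "W (real (q (Suc i mod m)))"]
      by (simp add: seg chord_def norm_W)
  qed
  have "outside (drawn \<gamma> E) = - cball 0 1"
  proof (rule outside_eq_compl_cball)
    show "sphere 0 1 \<subseteq> drawn \<gamma> E"
      using drawn_base by (auto simp: drawn_def)
    have "path_image (\<gamma> e) \<subseteq> cball 0 1" if "e \<in> cycle_edges ring" for e
      using chord_inside[OF that] edge[of e] that V_subset_sphere ball_subset_cball[of "0::complex" 1]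
        sphere_cball[of "0::complex" 1] by blast
    then show "drawn \<gamma> E \<subseteq> cball 0 1"
      using drawn_base sphere_cball[of "0::complex" 1] unfolding drawn_def by blast
  qed simp
  then have "frontier (outside (drawn \<gamma> E)) = drawn \<gamma> (cycle_edges base)"
    by (simp add: frontier_complement drawn_base)
  then have "plane_cycle_with_chords V E \<gamma> base"
    unfolding plane_cycle_with_chords_def is_cycle_def
    using plane n_ge chord_inside drawn_base inside
    by (intro conjI exI[of _ "cycle_edges base"]) (auto simp: base_simps(1,2))
  moreover have "is_cycle ring (E - cycle_edges base)"
    using base_ring_disjoint m by (auto simp: is_cycle_def ring_simps)
  ultimately show ?thesis
    unfolding two_nested_cycles_def using base_simps(1) ring_simps(1) by blast
qed

text \<open>A labelling of positions becomes one of points of the plane by composition with the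
  inverse of \<open>W\<close> on the vertices.\<close>

lemma transfer_labelling:
  fixes f :: "nat \<Rightarrow> int"
  assumes "inj_on f {..<n}"
  obtains g where "inj_on g V" "g ` V = f ` {..<n}"
    "edge_differences E g = (\<lambda>k. \<bar>f k - f (Suc k mod n)\<bar>) ` {..<n}
      \<union> (\<lambda>i. \<bar>f (q i) - f (q (Suc i mod m))\<bar>) ` {..<m}"
proof
  define pos where "pos = the_inv_into {..<n} (\<lambda>i. W (real i))"
  define g where "g = f \<circ> pos"
  have "inj_on (\<lambda>i. W (real i)) {..<n}"
    by (auto simp: inj_on_def W_eq_iff_nat)
  then have g: "g (W (real k)) = f k" if "k < n" for k
    using that the_inv_into_f_f[of "\<lambda>i. W (real i)" "{..<n}" k] by (simp add: g_def pos_def)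
  show "inj_on g V"
    using assms by (auto simp: inj_on_def base_simps g)
  show "g ` V = f ` {..<n}"
    unfolding base_simps image_image by (rule image_cong) (simp_all add: g)
  have "edge_differences (cycle_edges base) g = (\<lambda>k. \<bar>f k - f (Suc k mod n)\<bar>) ` {..<n}"
    unfolding edge_differences_cycle_edges base_simps(1)
    by (rule image_cong) (use n_ge in \<open>auto simp: base_def g\<close>)
  moreover have "edge_differences (cycle_edges ring) g
      = (\<lambda>i. \<bar>f (q i) - f (q (Suc i mod m))\<bar>) ` {..<m}"
    unfolding edge_differences_cycle_edges ring_simps(1)
    by (rule image_cong) (use m in \<open>auto simp: ring_def g q_less_n\<close>)
  ultimately show "edge_differences E g = (\<lambda>k. \<bar>f k - f (Suc k mod n)\<bar>) ` {..<n}
      \<union> (\<lambda>i. \<bar>f (q i) - f (q (Suc i mod m))\<bar>) ` {..<m}"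
    by (simp add: edge_differences_Un)
qed

lemma not_graceful: "(m + n) mod 4 \<in> {1, 2} \<Longrightarrow> \<not> graceful V E"
  using graceful_two_cycles_mod_4[of base ring V] base_ring_disjoint m n_ge
  by (auto simp: base_simps(1,2) ring_simps add.commute)

end

subsection \<open>The zigzag labelling\<close>

text \<open>The labels are \<open>L \<plusminus> r p\<close> with alternating sign, where \<open>p\<close> is the distance from the last
  vertex of the zigzag, so that consecutive differences are \<open>r p + r (p + 1)\<close>. The sequence \<open>r\<close> is a
  superposition: \<open>ramp m\<close> produces the differences \<open>m, m + 1, \<dots>\<close>, and \<open>jump c\<close> raises all of them
  from index \<open>c\<close> on by 1, which skips one.\<close>

definition jump :: "nat \<Rightarrow> nat \<Rightarrow> int" where
  "jump c p = of_bool (c < p \<and> odd (p - c))"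

lemma jump_Suc: "jump c p + jump c (Suc p) = of_bool (c \<le> p)"
  by (auto simp: jump_def Suc_diff_le le_less)

lemma jump_mono: "jump c p \<le> jump c (p + 2)"
  by (auto simp: jump_def)

lemma jump_above: "c < p \<Longrightarrow> jump c (p + 2) = jump c p"
  by (auto simp: jump_def)

definition ramp :: "nat \<Rightarrow> nat \<Rightarrow> int" where
  "ramp m p = (if even p then int (p div 2) else int (m + p div 2))"

lemma ramp_Suc: "ramp m p + ramp m (Suc p) = int (m + p)"
  by (auto simp: ramp_def elim!: evenE oddE)

lemma ramp_add_2: "ramp m (p + 2) = ramp m p + 1"
  by (auto simp: ramp_def)

text \<open>The jump at \<open>a\<close> skips the difference \<open>m + a = D\<close>, the one at \<open>j\<close> skips \<open>L = m + j + 1\<close>;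
  \<open>\<nu>\<close> is 1 in the near-graceful case and 0 in the graceful one. There are \<open>N + 2\<close> vertices.\<close>

locale zigzag =
  fixes m N a j \<nu> :: nat
  assumes m: "1 \<le> m"
    and aj: "a \<le> j" and jN: "j \<le> N"
    and even_j: "even (Suc N - j)"
    and close: "int (m + j + 1) = ramp m (Suc N) + jump a (Suc N) + int \<nu>"
begin

text \<open>The last summand affects only the first vertex of the zigzag. It lengthens only the
  first difference, from \<open>m + N + 2\<close> to \<open>m + N + 2 + \<nu>\<close>.\<close>

definition r :: "nat \<Rightarrow> int" where
  "r p = ramp m p + jump a p + jump j p + (if p = Suc N then int \<nu> else 0)"

definition h :: "nat \<Rightarrow> int" where
  "h p = int (m + p) + of_bool (a \<le> p) + of_bool (j \<le> p) + (if p = N then int \<nu> else 0)"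

definition L :: int where
  "L = int (m + j + 1)"

definition f :: "nat \<Rightarrow> int" where
  "f k = (if odd k then L + r (Suc N - k) else L - r (Suc N - k))"

lemma r_Suc: "p \<le> N \<Longrightarrow> r p + r (Suc p) = h p"
  using ramp_Suc[of m p] jump_Suc[of a p] jump_Suc[of j p] by (auto simp: r_def h_def)

lemma r_0: "r 0 = 0"
  by (simp add: r_def ramp_def jump_def)

text \<open>By \<open>even_j\<close> the jump at \<open>j\<close> contributes 0 here, so
  \<open>close\<close> says exactly that the first label \<open>f 0\<close> is 0. The edge from the
  last vertex, labelled \<open>L\<close>, back to it then has difference \<open>L\<close>.\<close>

lemma r_last: "r (Suc N) = L"
proof -
  have "jump j (Suc N) = 0" using even_j by (simp add: jump_def)
  then show ?thesis using close by (simp add: r_def L_def)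
qed

lemma r_add_2: "p < N \<Longrightarrow> r p + 1 \<le> r (p + 2)"
  using ramp_add_2[of m p] jump_mono[of a p] jump_mono[of j p] unfolding r_def by auto

text \<open>Beyond both jumps, and short of the extra \<open>\<nu>\<close> at \<open>Suc N\<close>,
  labels on one side of \<open>L\<close> are consecutive. The chord vertices are placed in this
  region.\<close>

lemma r_add_2_eq: "j < p \<Longrightarrow> p + 1 < N \<Longrightarrow> r (p + 2) = r p + 1"
  using ramp_add_2[of m p] jump_above[of a p] jump_above[of j p] aj unfolding r_def by auto

lemma r_less_add_even: "0 < d \<Longrightarrow> p + 2 * d \<le> Suc N \<Longrightarrow> r p < r (p + 2 * d)"
proof (induction d)
  case (Suc d)
  show ?case
  proof (cases "d = 0")
    case True
    then show ?thesis using r_add_2[of p] Suc.prems by simp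
  next
    case False
    then show ?thesis using r_add_2[of "p + 2 * d"] Suc by (simp add: algebra_simps)
  qed
qed simp

lemma r_less:
  assumes "p < p'" "p' \<le> Suc N" "even p = even p'"
  shows "r p < r p'"
proof -
  have "even (p' - p)" using assms by simp
  then obtain d where "p' - p = 2 * d" by (rule evenE)
  then have "p' = p + 2 * d" "0 < d" using assms by simp_all
  then show ?thesis using r_less_add_even assms by simp
qed

lemma r_le: "p \<le> p' \<Longrightarrow> p' \<le> Suc N \<Longrightarrow> even p = even p' \<Longrightarrow> r p \<le> r p'"
  using r_less[of p p'] by (cases "p = p'") auto

lemma r_eq_iff: "p \<le> Suc N \<Longrightarrow> p' \<le> Suc N \<Longrightarrow> even p = even p' \<Longrightarrow> r p = r p' \<longleftrightarrow> p = p'"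
  using r_less[of p p'] r_less[of p' p] by (cases p p' rule: linorder_cases) auto

lemma r_pos:
  assumes "0 < p" "p \<le> Suc N"
  shows "0 < r p"
proof (cases "even p")
  case True
  then show ?thesis using r_less[of 0 p] r_0 assms by simp
next
  case False
  then show ?thesis using m by (simp add: r_def ramp_def jump_def)
qed

lemma r_nonneg: "p \<le> Suc N \<Longrightarrow> 0 \<le> r p"
  using r_pos[of p] r_0 by (cases "p = 0") auto

text \<open>Labels at odd positions are at least \<open>L\<close>, those at even positions at most
  \<open>L\<close>, and \<open>r\<close> is strictly increasing on each parity class. The value
  \<open>L\<close> itself occurs only at the last vertex, where \<open>r\<close> is 0.\<close>

lemma inj_on_f: "inj_on f {..<N + 2}"
proof (rule inj_onI)
  fix k l assume kl: "k \<in> {..<N + 2}" "l \<in> {..<N + 2}" and eq: "f k = f l"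
  have lt: "Suc N - k \<le> Suc N" "Suc N - l \<le> Suc N" by auto
  show "k = l"
  proof (cases "even k = even l")
    case True
    then have "r (Suc N - k) = r (Suc N - l)"
      using eq by (auto simp: f_def split: if_splits)
    moreover have "even (Suc N - k) = even (Suc N - l)"
      using True kl by auto
    ultimately have "Suc N - k = Suc N - l"
      using r_eq_iff lt by simp
    then show ?thesis using kl by auto
  next
    case False
    then have "r (Suc N - k) + r (Suc N - l) = 0"
      using eq by (auto simp: f_def split: if_splits)
    then have "r (Suc N - k) = 0" "r (Suc N - l) = 0"
      using r_nonneg[OF lt(1)] r_nonneg[OF lt(2)] by linarith+
    then have "Suc N - k = 0" "Suc N - l = 0"
      using r_pos lt by (metis less_irrefl gr0I)+
    then show ?thesis using kl by auto
  qed
qed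

text \<open>The extreme labels are those of the first two vertices: 0 at position 0 and
  \<open>L + r N\<close> at position 1.\<close>

lemma f_range: "f ` {..<N + 2} \<subseteq> {0..int (m + (N + 2) + \<nu>)}"
proof
  fix y assume "y \<in> f ` {..<N + 2}"
  then obtain k where "k < N + 2" and k: "y = f k" by auto
  then have "k \<le> Suc N" by simp
  note k = this k
  have top: "r N + L = int (m + (N + 2) + \<nu>)"
    using r_Suc[of N] r_last jN aj by (simp add: h_def)
  have nonneg: "0 \<le> L" "0 \<le> r N" "0 \<le> r (Suc N - k)"
    using r_nonneg by (simp_all add: L_def)
  show "y \<in> {0..int (m + (N + 2) + \<nu>)}"
  proof (cases "even k")
    case True
    then have "r (Suc N - k) \<le> L"
      using r_le[of "Suc N - k" "Suc N"] r_last k by simp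
    then show ?thesis
      using True k nonneg top by (simp add: f_def)
  next
    case False
    then have "1 \<le> k" by (cases k) auto
    then have "r (Suc N - k) \<le> r N"
      using r_le[of "Suc N - k" N] False k by auto
    then show ?thesis
      using False k nonneg top by (simp add: f_def)
  qed
qed

lemma f_Suc:
  assumes "k \<le> N"
  shows "\<bar>f k - f (Suc k)\<bar> = h (N - k)"
proof -
  have "r (N - k) + r (Suc (N - k)) = h (N - k)" "0 \<le> r (N - k)" "0 \<le> r (Suc (N - k))"
    using r_Suc[of "N - k"] r_nonneg[of "N - k"] r_nonneg[of "Suc (N - k)"] by simp_all
  then show ?thesis
    using assms by (auto simp: f_def Suc_diff_le)
qed

lemma f_close: "\<bar>f (Suc N) - f 0\<bar> = L"
  using r_0 r_last by (simp add: f_def) (simp add: L_def)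

lemma cycle_differences:
  "(\<lambda>k. \<bar>f k - f (Suc k mod (N + 2))\<bar>) ` {..<N + 2} = insert L (h ` {..N})"
proof -
  have "{..<N + 2} = insert (Suc N) {..N}" by auto
  then have "(\<lambda>k. \<bar>f k - f (Suc k mod (N + 2))\<bar>) ` {..<N + 2}
      = insert L ((\<lambda>k. \<bar>f k - f (Suc k mod (N + 2))\<bar>) ` {..N})"
    using f_close by simp
  also have "(\<lambda>k. \<bar>f k - f (Suc k mod (N + 2))\<bar>) ` {..N} = (\<lambda>k. h (N - k)) ` {..N}"
    by (rule image_cong) (use f_Suc in auto)
  also have "\<dots> = h ` (\<lambda>k. N - k) ` {..N}"
    by (simp add: image_image)
  also have "(\<lambda>k. N - k) ` {..N} = {..N}"
  proof
    show "{..N} \<subseteq> (\<lambda>k. N - k) ` {..N}"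
    proof
      fix x assume "x \<in> {..N}"
      then show "x \<in> (\<lambda>k. N - k) ` {..N}"
        using image_eqI[of x "\<lambda>k. N - k" "N - x" "{..N}"] by simp
    qed
  qed auto
  finally show ?thesis .
qed

lemma h_cases:
  obtains "p < a" "p < N" "h p = int (m + p)"
  | "a \<le> p" "p < j" "h p = int (m + p + 1)"
  | "j \<le> p" "p < N" "h p = int (m + p + 2)"
  | "p = N" "h p = int (m + N + 2 + \<nu>)"
  | "N < p"
  using aj jN by (cases "p < a"; cases "p < j"; cases "p < N"; cases "p = N") (auto simp: h_def)

text \<open>The shifts at \<open>a\<close> and \<open>j\<close> make \<open>h\<close> leap over
  \<open>m + a\<close> and \<open>m + j + 1\<close>. The latter is \<open>L\<close>, which the
  closing edge restores; \<open>\<nu> = 1\<close> opens the further gap below the largest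
  value.\<close>

lemma h_image:
  assumes "\<nu> \<le> 1"
  shows "insert L (h ` {..N})
    = {int m..int (m + (N + 2) + \<nu>)} - {int (m + a)} - (if \<nu> = 1 then {int (m + (N + 2))} else {})"
proof -
  define R where
    "R = {int m..int (m + (N + 2) + \<nu>)} - {int (m + a)} - (if \<nu> = 1 then {int (m + (N + 2))} else {})"
  have mem: "int (m + x) \<in> R \<longleftrightarrow> x \<noteq> a \<and> x \<le> N + 2 + \<nu> \<and> (\<nu> = 1 \<longrightarrow> x \<noteq> N + 2)" for x
    by (auto simp: R_def)
  have "h p \<in> R" if "p \<le> N" for p
  proof (cases rule: h_cases[of p])
    case 1
    then show ?thesis using mem[of p] by simp
  next
    case 2
    then show ?thesis using mem[of "p + 1"] jN by simp
  next
    case 3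
    then show ?thesis using mem[of "p + 2"] aj by simp
  next
    case 4
    then show ?thesis using mem[of "N + 2 + \<nu>"] aj jN by (simp add: add.assoc)
  next
    case 5
    then show ?thesis using that by simp
  qed
  moreover have "L \<in> R"
    using mem[of "j + 1"] aj jN by (simp add: L_def)
  ultimately have "insert L (h ` {..N}) \<subseteq> R"
    by blast
  moreover have "R \<subseteq> insert L (h ` {..N})"
  proof
    fix y assume y: "y \<in> R"
    define p where "p = nat (y - int m)"
    have "int m \<le> y" using y by (simp add: R_def)
    then have yp: "y = int (m + p)" by (simp add: p_def)
    then have "p \<noteq> a" "p \<le> N + 2 + \<nu>" and "\<nu> = 1 \<Longrightarrow> p \<noteq> N + 2"
      using y mem[of p] by auto
    then consider "p < a" | "a < p" "p \<le> j" | "p = j + 1" | "j + 1 < p" "p < N + 2" | "p = N + 2 + \<nu>"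
      using assms by linarith
    then have "y = L \<or> (\<exists>x\<le>N. y = h x)"
    proof cases
      case 1
      then have "y = h p" "p \<le> N" using yp aj jN by (auto simp: h_def)
      then show ?thesis by blast
    next
      case 2
      then have "y = h (p - 1)" "p - 1 \<le> N" using yp aj jN by (auto simp: h_def)
      then show ?thesis by blast
    next
      case 3
      then show ?thesis using yp by (simp add: L_def)
    next
      case 4
      then have "y = h (p - 2)" "p - 2 \<le> N" using yp aj jN by (auto simp: h_def)
      then show ?thesis by blast
    next
      case 5
      then have "y = h N" using yp aj jN by (auto simp: h_def)
      then show ?thesis by blast
    qed
    then show "y \<in> insert L (h ` {..N})" by auto
  qed
  ultimately show ?thesis
    unfolding R_def[symmetric] by (rule subset_antisym)
qed

text \<open>The hypothesis says that position \<open>1 + 2 * t\<close>, at distance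
  \<open>N - 2 * t\<close> from the end, still lies beyond the jump at \<open>j\<close>.\<close>

lemma f_odd: "j + 2 * t < N \<Longrightarrow> f (1 + 2 * t) = f 1 - int t"
proof (induction t)
  case (Suc t)
  define p where "p = N - 2 * Suc t"
  have p: "j < p" "p + 1 < N" "N - 2 * t = p + 2"
    using Suc.prems by (auto simp: p_def)
  have "f (1 + 2 * Suc t) = f (1 + 2 * t) - 1"
    using r_add_2_eq[OF p(1,2)] p(3) by (simp add: f_def p_def)
  then show ?case using Suc by simp
qed simp

text \<open>Chord \<open>i\<close> joins the vertices whose labels lie below \<open>f 1\<close> by the \<open>i\<close>-th and the next
  triangular number.\<close>
lemma chord_differences:
  assumes "2 \<le> m" and D: "m * (m - 1) = 2 * (m + a)" and "j + m * (m - 1) < N"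
  shows "(\<lambda>i. \<bar>f (1 + i * (i + 1)) - f (1 + (Suc i mod m) * (Suc i mod m + 1))\<bar>) ` {..<m}
    = insert (int (m + a)) {1..int m - 1}"
proof -
  define t where "t i = i * (i + 1) div 2" for i :: nat
  have t: "i * (i + 1) = 2 * t i" for i
    by (simp add: t_def)
  have f_t: "f (1 + i * (i + 1)) = f 1 - int (t i)" if "i < m" for i
  proof -
    have "i * (i + 1) \<le> (m - 1) * (m - 1 + 1)"
      using that by (intro mult_mono) auto
    also have "\<dots> = m * (m - 1)"
      using \<open>2 \<le> m\<close> by (simp add: mult.commute)
    finally have "j + 2 * t i < N"
      using assms(3) t[of i] by linarith
    then show ?thesis
      using f_odd t by metis
  qed
  have t_Suc: "t (Suc i) = t i + Suc i" for i
    using t[of i] t[of "Suc i"] by simp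
  \<comment> \<open>The largest triangular number used is the difference skipped at
    \<open>a\<close>, so the closing chord supplies it.\<close>
  have t_last: "t (m - 1) = m + a"
    using t[of "m - 1"] D \<open>2 \<le> m\<close> by (simp add: mult.commute)
  define d where "d i = \<bar>f (1 + i * (i + 1)) - f (1 + (Suc i mod m) * (Suc i mod m + 1))\<bar>" for i
  have "d i = int (Suc i)" if "i < m - 1" for i
  proof -
    have "Suc i mod m = Suc i" "i < m" "Suc i < m"
      using that by auto
    then show ?thesis
      unfolding d_def using f_t[of i] f_t[of "Suc i"] t_Suc[of i] by simp
  qed
  then have "d ` {..<m - 1} = int ` Suc ` {..<m - 1}"
    by (simp add: image_image)
  also have "\<dots> = {1..int m - 1}"
  proof -
    have "Suc ` {..<m - 1} = {1..m - 1}"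
      by (simp add: lessThan_atLeast0 atLeastLessThanSuc_atLeastAtMost)
    then show ?thesis
      using image_int_atLeastAtMost[of 1 "m - 1"] \<open>2 \<le> m\<close> by (simp add: of_nat_diff)
  qed
  finally have "d ` {..<m - 1} = {1..int m - 1}" .
  moreover have "d (m - 1) = int (m + a)"
  proof -
    have "t 0 = 0" by (simp add: t_def)
    moreover have "Suc (m - 1) mod m = 0" "m - 1 < m" "0 < m" using \<open>2 \<le> m\<close> by auto
    ultimately show ?thesis
      unfolding d_def using f_t[of "m - 1"] f_t[of 0] t_last by simp
  qed
  moreover have "{..<m} = insert (m - 1) {..<m - 1}" using \<open>2 \<le> m\<close> by auto
  ultimately have "d ` {..<m} = insert (int (m + a)) {1..int m - 1}"
    by simp
  then show ?thesis
    by (simp add: d_def)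
qed

end

section \<open>Choice of the parameters and assembly\<close>

text \<open>The equation \<open>close\<close> determines \<open>j\<close>. Its parity requirement
  then reduces to the choice of \<open>\<nu>\<close> by the residue of \<open>m + n\<close>, and the
  lower bound on \<open>n\<close> leaves room for all chord vertices before the jump at
  \<open>j\<close>.\<close>

lemma zigzag_parameters:
  fixes m n D :: nat
  assumes "3 \<le> m" "m * (2 * m - 1) \<le> n" "m * (m - 1) = 2 * D"
  defines "\<nu> \<equiv> of_bool ((m + n) mod 4 \<in> {1, 2})"
  obtains j where "zigzag m (n - 2) (D - m) j \<nu>" "j + m * (m - 1) < n - 2" "m \<le> D"
proof -
  have mD: "m \<le> D"
  proof -
    have "m * 2 \<le> m * (m - 1)" using assms(1) by (intro mult_le_mono) auto
    then show ?thesis using assms(3) by linarith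
  qed
  have nD: "4 * D + m \<le> n"
  proof -
    \<comment> \<open>The bound on the base length is \<open>4 * D + m\<close> in disguise.\<close>
    have "m * (2 * m - 1) = 2 * (m * (m - 1)) + m"
      using assms(1) by (cases m) (auto simp: algebra_simps)
    then show ?thesis using assms(2,3) by simp
  qed
  have even_D: "even D \<longleftrightarrow> m mod 4 \<in> {0, 1}"
  proof -
    define u v where "u = m div 4" and "v = m mod 4"
    have muv: "m = 4 * u + v" and "v < 4" by (simp_all add: u_def v_def)
    have "int m * (int m - 1) = 2 * int D"
      using assms(1) arg_cong[OF assms(3), of int] by (simp add: of_nat_diff)
    then have "2 * int D = 4 * (4 * int u * int u + 2 * int u * int v - int u) + int v * (int v - 1)"
      unfolding muv by (simp add: algebra_simps)
    moreover have "v = 0 \<or> v = 1 \<or> v = 2 \<or> v = 3" using \<open>v < 4\<close> by linarith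
    ultimately have "int D = 2 * (4 * int u * int u + 2 * int u * int v - int u)
        + (if v = 2 then 1 else if v = 3 then 3 else 0)"
      by auto
    then have "even (int D) \<longleftrightarrow> v \<in> {0, 1}"
      using \<open>v = 0 \<or> v = 1 \<or> v = 2 \<or> v = 3\<close> by auto
    then show ?thesis by (simp add: v_def)
  qed
  then have even_D: "even D \<longleftrightarrow> m mod 4 = 0 \<or> m mod 4 = 1"
    by simp
  have \<nu>: "\<nu> = (if (m + n) mod 4 = 1 \<or> (m + n) mod 4 = 2 then 1 else 0)"
    by (simp add: \<nu>_def)
  \<comment> \<open>This is \<open>close\<close> solved for \<open>j\<close>: at
    \<open>n - 1\<close> the ramp is \<open>m + n div 2 - 1\<close> for even \<open>n\<close> and
    \<open>n div 2\<close> for odd \<open>n\<close>, and the jump at \<open>D - m\<close> is the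
    inner conditional.\<close>
  define j where "j = (if even n then n div 2 - 2 + (if even (D + m) then 1 else 0) + \<nu>
    else n div 2 - m - 1 + (if odd (D + m) then 1 else 0) + \<nu>)"
  have j: "int (m + j + 1) = ramp m (n - 1) + jump (D - m) (n - 1) + int \<nu>
     \<and> even (n - 1 - j) \<and> D - m \<le> j \<and> j + 2 * D < n - 2"
  proof (cases "even n")
    case True
    then obtain c where c: "n = 2 * c" by (rule evenE)
    have j: "j = c - 2 + (if even (D + m) then 1 else 0) + \<nu>"
      using True by (simp add: j_def c)
    have "jump (D - m) (n - 1) = of_bool (even (D + m))"
      using c nD mD assms(1) by (auto simp: jump_def)
    moreover have "ramp m (n - 1) = int m + int c - 1"
      using c nD assms(1) by (auto simp: ramp_def)
    moreover have "odd (c + (if even (D + m) then 1 else 0) + \<nu>)"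
      using even_D unfolding \<nu> c by presburger
    moreover define e :: nat where "e = (if even (D + m) then 1 else 0)"
    ultimately have facts: "jump (D - m) (n - 1) = int e" "ramp m (n - 1) = int m + int c - 1"
      "odd (c + e + \<nu>)"
      by simp_all
    have e: "j = c - 2 + e + \<nu>" "e \<le> 1" "\<nu> \<le> 1"
      using j \<nu> by (simp_all add: e_def)
    have c2: "2 * D + 2 \<le> c"
      using c nD assms(1) by linarith
    have "2 * D + e + \<nu> < c"
    \<comment> \<open>The size bound alone just fails when \<open>e + \<nu> = 2\<close> and
      \<open>c = 2 * D + 2\<close>; the parity of \<open>c + e + \<nu>\<close> excludes this
      case.\<close>
    proof (cases "e + \<nu> = 2")
      case True
      then have "c \<noteq> 2 * D + 2" using facts(3) by (auto simp: add.assoc)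
      then show ?thesis using c2 True by linarith
    qed (use c2 e in linarith)
    moreover have "odd j"
      using facts(3) c2 unfolding e(1) by simp
    ultimately show ?thesis
      using e c c2 mD assms(1) unfolding facts(1,2) by auto
  next
    case False
    then obtain c where c: "n = 2 * c + 1" by (rule oddE)
    have j: "j = c - m - 1 + (if odd (D + m) then 1 else 0) + \<nu>"
      using False by (simp add: j_def c)
    have "jump (D - m) (n - 1) = of_bool (odd (D + m))"
      using c nD mD assms(1) by (auto simp: jump_def)
    moreover have "ramp m (n - 1) = int c"
      using c by (auto simp: ramp_def)
    moreover have "odd (c + m + (if odd (D + m) then 1 else 0) + \<nu>)"
      using even_D unfolding \<nu> c by presburger
    moreover define e :: nat where "e = (if odd (D + m) then 1 else 0)"
    ultimately have facts: "jump (D - m) (n - 1) = int e" "ramp m (n - 1) = int c"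
      "odd (c + m + e + \<nu>)"
      by simp_all
    have e: "j = c - m - 1 + e + \<nu>" "e \<le> 1" "\<nu> \<le> 1"
      using j \<nu> by (simp_all add: e_def)
    have c2: "2 * D + 1 \<le> c"
      using c nD assms(1) by linarith
    have "even j"
      using facts(3) c2 mD unfolding e(1) by auto
    then show ?thesis
      using e c c2 mD assms(1) unfolding facts(1,2) by auto
  qed
  have "zigzag m (n - 2) (D - m) j \<nu>"
  proof
    have "Suc (n - 2) = n - 1" using nD assms(1) by simp
    then show "even (Suc (n - 2) - j)"
      "int (m + j + 1) = ramp m (Suc (n - 2)) + jump (D - m) (Suc (n - 2)) + int \<nu>"
      using j by simp_all
  qed (use j assms(1) in auto)
  then show ?thesis using that j mD assms(3) by simp
qed

text \<open>Keeping \<open>\<nu>\<close> as a number treats the graceful and the near-graceful case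
  at once.\<close>

lemma ex_nested_labelling:
  fixes m n :: nat
  assumes m: "3 \<le> m" and n: "m * (2 * m - 1) \<le> n"
  defines "\<nu> \<equiv> of_bool ((m + n) mod 4 \<in> {1, 2}) :: nat"
  obtains V E \<gamma> g where "two_nested_cycles m n V E \<gamma>" "card E = m + n" "inj_on g V"
    "g ` V \<subseteq> {0..int (m + n + \<nu>)}"
    "edge_differences E g = {1..int (m + n + \<nu>)} - (if \<nu> = 1 then {int (m + n)} else {})"
    "(m + n) mod 4 \<in> {1, 2} \<Longrightarrow> \<not> graceful V E"
proof -
  have "even (m * (m - 1))" by (cases "even m") auto
  then obtain D where D: "m * (m - 1) = 2 * D" by (rule evenE)
  obtain j where zz: "zigzag m (n - 2) (D - m) j \<nu>" and j: "j + m * (m - 1) < n - 2"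
    and mD: "m \<le> D"
    using zigzag_parameters[OF m n D] unfolding \<nu>_def by blast
  interpret Z: zigzag m "n - 2" "D - m" j \<nu> by (fact zz)
  \<comment> \<open>These are the odd positions \<open>1 + 2 * t\<close> with \<open>t\<close>
    triangular, so by \<open>f_odd\<close> the chord labels lie triangular numbers below the largest
    label.\<close>
  define q where "q i = 1 + i * (i + 1)" for i :: nat
  interpret G: inscribed_cycle n m q
  proof
    have "q (m - 1) = 1 + m * (m - 1)"
      using m by (simp add: q_def mult.commute)
    then show "q (m - 1) < n" using j by linarith
  qed (use m in \<open>auto simp: q_def\<close>)
  have n2: "n - 2 + 2 = n" using j by simp
  obtain g where g: "inj_on g G.V" "g ` G.V = Z.f ` {..<n}"
    "edge_differences G.E g = (\<lambda>k. \<bar>Z.f k - Z.f (Suc k mod n)\<bar>) ` {..<n}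
      \<union> (\<lambda>i. \<bar>Z.f (q i) - Z.f (q (Suc i mod m))\<bar>) ` {..<m}"
    using G.transfer_labelling[of Z.f] Z.inj_on_f unfolding n2 by blast
  have \<nu>: "\<nu> \<le> 1" by (simp add: \<nu>_def)
  have "(\<lambda>k. \<bar>Z.f k - Z.f (Suc k mod n)\<bar>) ` {..<n}
      = {int m..int (m + n + \<nu>)} - {int D} - (if \<nu> = 1 then {int (m + n)} else {})"
    using Z.cycle_differences Z.h_image[OF \<nu>] mD unfolding n2 by simp
  moreover have "(\<lambda>i. \<bar>Z.f (q i) - Z.f (q (Suc i mod m))\<bar>) ` {..<m} = insert (int D) {1..int m - 1}"
    using Z.chord_differences D j m mD unfolding q_def by simp
  \<comment> \<open>Hence \<open>D\<close> lies strictly below \<open>m + n\<close>: it fills the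
    hole left by the base cycle and does not refill the one at \<open>m + n\<close> when
    \<open>\<nu> = 1\<close>.\<close>
  moreover have "2 * D < n" using j D by linarith
  ultimately have "edge_differences G.E g
      = {1..int (m + n + \<nu>)} - (if \<nu> = 1 then {int (m + n)} else {})"
    unfolding g(3) using m mD by auto
  moreover obtain \<gamma> where "two_nested_cycles m n G.V G.E \<gamma>"
    using G.ex_plane_drawing by blast
  moreover have "g ` G.V \<subseteq> {0..int (m + n + \<nu>)}"
    using g(2) Z.f_range unfolding n2 by simp
  ultimately show ?thesis
    using that G.card_E G.not_graceful g(1) by blast
qed

theorem theorem3:
  fixes m\<^sub>1 m\<^sub>2 :: nat
  assumes "m\<^sub>1 \<ge> 3"
    and "m\<^sub>2 \<ge> m\<^sub>1 * (2 * m\<^sub>1 - 1)"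
  shows "((m\<^sub>1 + m\<^sub>2) mod 4 \<in> {0, 3} \<longrightarrow> nested_graceful m\<^sub>1 m\<^sub>2 \<noteq> {}) \<and>
         ((m\<^sub>1 + m\<^sub>2) mod 4 \<in> {1, 2} \<longrightarrow> nested_near_graceful m\<^sub>1 m\<^sub>2 \<noteq> {})"
proof -
  define \<nu> :: nat where "\<nu> = of_bool ((m\<^sub>1 + m\<^sub>2) mod 4 \<in> {1, 2})"
  obtain V E \<gamma> g where nested: "two_nested_cycles m\<^sub>1 m\<^sub>2 V E \<gamma>" and card: "card E = m\<^sub>1 + m\<^sub>2"
    and g: "inj_on g V" "g ` V \<subseteq> {0..int (m\<^sub>1 + m\<^sub>2 + \<nu>)}"
      "edge_differences E g
        = {1..int (m\<^sub>1 + m\<^sub>2 + \<nu>)} - (if \<nu> = 1 then {int (m\<^sub>1 + m\<^sub>2)} else {})"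
    and not_graceful: "(m\<^sub>1 + m\<^sub>2) mod 4 \<in> {1, 2} \<Longrightarrow> \<not> graceful V E"
    using ex_nested_labelling[OF assms] unfolding \<nu>_def by blast
  have "graceful V E" if "(m\<^sub>1 + m\<^sub>2) mod 4 \<in> {0, 3}"
  proof -
    have "\<nu> = 0" using that by (auto simp: \<nu>_def)
    then show ?thesis
      unfolding graceful_def card using g by (intro exI[of _ g]) simp
  qed
  moreover have "near_graceful V E" if "(m\<^sub>1 + m\<^sub>2) mod 4 \<in> {1, 2}"
  proof -
    have "\<nu> = 1" using that by (simp add: \<nu>_def)
    moreover have "{1..int (m\<^sub>1 + m\<^sub>2) + 1} - {int (m\<^sub>1 + m\<^sub>2)}
        = {1..int (m\<^sub>1 + m\<^sub>2) - 1} \<union> {int (m\<^sub>1 + m\<^sub>2) + 1}"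
      by auto
    ultimately show ?thesis
      unfolding near_graceful_def card using g not_graceful[OF that]
      by (intro conjI exI[of _ g]) (simp_all add: add.commute)
  qed
  ultimately have "(m\<^sub>1 + m\<^sub>2) mod 4 \<in> {0, 3} \<Longrightarrow> (V, E, \<gamma>) \<in> nested_graceful m\<^sub>1 m\<^sub>2"
    and "(m\<^sub>1 + m\<^sub>2) mod 4 \<in> {1, 2} \<Longrightarrow> (V, E, \<gamma>) \<in> nested_near_graceful m\<^sub>1 m\<^sub>2"
    using nested by (simp_all add: nested_graceful_def nested_near_graceful_def)
  then show ?thesis
    by (metis empty_iff)
qed

end
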